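(* Let $n\geq 1$ and let $G=\mathrm{Sym}^{n-1}(\mathrm{SL}_2)\leq\mathrm{GL}_n$ be the image of $\mathrm{SL}_2$ under its irreducible $n$-dimensional representation $\mathrm{Sym}^{n-1}(\mathbb{C}^2)$. Then the representation $\mathrm{Sym}^3:\mathrm{GL}_n\to\mathrm{GL}(\mathrm{Sym}^3\mathbb{C}^n)$ detects $G$ if and only if $n\equiv 1\pmod 4$.
   Context: All groups are complex algebraic groups. For a subgroup $G\leq\mathrm{GL}_n$ and a representation $r:\mathrm{GL}_n\to\mathrm{GL}(V_r)$, one says $r$ detects $G$ if $G$ fixes a line in $V_r$ (i.e., $r(G)$ preserves some one-dimensional subspace of $V_r$). *)

theory Defs
  imports
    "HOL-Library.Poly_Mapping"
    "HOL-Number_Theory.Cong"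
    "Jordan_Normal_Form.Determinant"
begin

type_synonym cpoly = "(nat \<Rightarrow>\<^sub>0 nat) \<Rightarrow>\<^sub>0 complex"

definition const :: "complex \<Rightarrow> cpoly"
  where "const c = Poly_Mapping.single 0 c"

definition var :: "nat \<Rightarrow> cpoly"
  where "var i = Poly_Mapping.single (Poly_Mapping.single i 1) 1"

definition scale :: "complex \<Rightarrow> cpoly \<Rightarrow> cpoly"
  where "scale c p = const c * p"

interpretation cpoly: vector_space scale
  by unfold_locales
    (simp_all add: scale_def const_def algebra_simps single_add mult_single flip: mult.assoc)

text \<open>
  The symmetric algebra of \<open>\<complex>\<^sup>n\<close> with standard basis \<open>e\<^sub>0, \<dots>, e\<^bsub>n-1\<^esub>\<close> is the polynomial
  algebra in \<open>n\<close> variables, with \<open>var i\<close> in the role of \<open>e\<^sub>i\<close>; the \<open>k\<close>-th symmetric power is its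
  component of degree \<open>k\<close>.
\<close>

definition sym_power :: "nat \<Rightarrow> nat \<Rightarrow> cpoly set"
  where "sym_power k n =
    {p. \<forall>m \<in> Poly_Mapping.keys p. Poly_Mapping.keys m \<subseteq> {..<n} \<and>
          (\<Sum>i\<in>Poly_Mapping.keys m. Poly_Mapping.lookup m i) = k}"

definition subst :: "(nat \<Rightarrow> cpoly) \<Rightarrow> cpoly \<Rightarrow> cpoly"
  where "subst f p =
    (\<Sum>m\<in>Poly_Mapping.keys p. const (Poly_Mapping.lookup p m) *
      (\<Prod>i\<in>Poly_Mapping.keys m. f i ^ Poly_Mapping.lookup m i))"

text \<open>
  \<open>sym_action n A\<close> is the algebra endomorphism that sends \<open>e\<^sub>j\<close> to \<open>A e\<^sub>j\<close>, the \<open>j\<close>-th column of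
  \<open>A\<close>. On \<open>sym_power k n\<close> it is the operator \<open>Sym\<^sup>k A\<close>.
\<close>

definition sym_action :: "nat \<Rightarrow> complex mat \<Rightarrow> cpoly \<Rightarrow> cpoly"
  where "sym_action n A = subst (\<lambda>j. \<Sum>i<n. scale (A $$ (i, j)) (var i))"

definition SL :: "nat \<Rightarrow> complex mat set"
  where "SL n = {A \<in> carrier_mat n n. det A = 1}"

definition binary_monomial :: "nat \<Rightarrow> nat \<Rightarrow> nat \<Rightarrow>\<^sub>0 nat"
  where "binary_monomial d i = Poly_Mapping.single 0 (d - i) + Poly_Mapping.single 1 i"

text \<open>
  The matrix of \<open>Sym\<^sup>d A\<close>, for \<open>A\<close> of size 2, with respect to the basis
  \<open>e\<^sub>0\<^sup>d, e\<^sub>0\<^bsup>d-1\<^esup> e\<^sub>1, \<dots>, e\<^sub>1\<^sup>d\<close> of \<open>Sym\<^sup>d \<complex>\<^sup>2\<close>.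
\<close>

definition binary_sym_mat :: "nat \<Rightarrow> complex mat \<Rightarrow> complex mat"
  where "binary_sym_mat d A = mat (d + 1) (d + 1) (\<lambda>(i, j).
    Poly_Mapping.lookup
      (sym_action 2 A (Poly_Mapping.single (binary_monomial d j) 1)) (binary_monomial d i))"

definition sym_SL2 :: "nat \<Rightarrow> complex mat set"
  where "sym_SL2 d = binary_sym_mat d ` SL 2"

text \<open>
  \<open>detects s V r G\<close>: the group \<open>G\<close>, acting through \<open>r\<close> on the space \<open>V\<close> with scalar
  multiplication \<open>s\<close>, preserves a one-dimensional subspace of \<open>V\<close>.
\<close>

definition detects ::
  "(complex \<Rightarrow> 'v \<Rightarrow> 'v) \<Rightarrow> 'v::ab_group_add set \<Rightarrow> ('g \<Rightarrow> 'v \<Rightarrow> 'v) \<Rightarrow> 'g set \<Rightarrow> bool"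
  where "detects s V r G \<longleftrightarrow>
    (\<exists>L. module.subspace s L \<and> vector_space.dim s L = 1 \<and> L \<subseteq> V \<and> (\<forall>g\<in>G. r g ` L \<subseteq> L))"

end

theory Submission
  imports Defs
begin

text \<open>
  Let \<open>d = n - 1\<close>. An element of \<open>Sym\<^sup>3 (Sym\<^sup>d \<complex>\<^sup>2)\<close> is determined by its polarization, evaluated at
  triples of points \<open>u, v, w\<close> of \<open>\<complex>\<^sup>2\<close> that are mapped to the cone over the rational normal curve of
  degree \<open>d\<close>; this gives a symmetric function \<open>E (u, v, w)\<close>, homogeneous of degree \<open>d\<close> in each
  argument, on which \<open>SL\<^sub>2\<close> acts by substitution. Since triples of distinct lines form a single orbit,
  \<open>E\<close> is determined up to a scalar when it spans an invariant line, and it must be a multiple of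
  \<open>([u v] [v w] [w u])\<^bsup>d/2\<^esup>\<close>, which is symmetric exactly when \<open>d/2\<close> is even.
\<close>

section \<open>Substitution and evaluation\<close>

lemma const_0 [simp]: "const 0 = 0"
  and const_1 [simp]: "const 1 = 1"
  and const_add: "const (a + b) = const a + const b"
  and const_mult: "const (a * b) = const a * const b"
  by (simp_all add: const_def single_add mult_single)

lemma const_sum: "const (sum f S) = (\<Sum>i\<in>S. const (f i))"
  by (induction S rule: infinite_finite_induct) (simp_all add: const_add)

lemma const_prod: "const (prod f S) = (\<Prod>i\<in>S. const (f i))"
  by (induction S rule: infinite_finite_induct) (simp_all add: const_mult)

lemma const_power: "const (a ^ k) = const a ^ k"
  by (induction k) (simp_all add: const_mult)

lemma const_inject [simp]: "const a = const b \<longleftrightarrow> a = b"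
  unfolding const_def by (metis lookup_single_eq)

lemma sum_monomials: "p = (\<Sum>m\<in>Poly_Mapping.keys p. Poly_Mapping.single m (Poly_Mapping.lookup p m))"
  by (rule poly_mapping_eqI)
    (auto simp: lookup_sum lookup_single when_def in_keys_iff sum.delta' cong: if_cong)

definition monom_subst :: "(nat \<Rightarrow> cpoly) \<Rightarrow> (nat \<Rightarrow>\<^sub>0 nat) \<Rightarrow> cpoly"
  where "monom_subst f m = (\<Prod>i\<in>Poly_Mapping.keys m. f i ^ Poly_Mapping.lookup m i)"

lemma monom_subst_superset:
  assumes "finite S" "Poly_Mapping.keys m \<subseteq> S"
  shows "monom_subst f m = (\<Prod>i\<in>S. f i ^ Poly_Mapping.lookup m i)"
  unfolding monom_subst_def using assms
  by (intro prod.mono_neutral_left) (auto simp: in_keys_iff)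

lemma monom_subst_add: "monom_subst f (m + m') = monom_subst f m * monom_subst f m'"
proof -
  let ?S = "Poly_Mapping.keys m \<union> Poly_Mapping.keys m'"
  have "monom_subst f (m + m') = (\<Prod>i\<in>?S. f i ^ Poly_Mapping.lookup (m + m') i)"
    using keys_add[of m m'] by (intro monom_subst_superset) auto
  also have "\<dots> = monom_subst f m * monom_subst f m'"
    by (simp add: monom_subst_superset[of ?S] lookup_add power_add prod.distrib)
  finally show ?thesis .
qed

lemma subst_superset:
  assumes "finite S" "Poly_Mapping.keys p \<subseteq> S"
  shows "subst f p = (\<Sum>m\<in>S. const (Poly_Mapping.lookup p m) * monom_subst f m)"
  unfolding subst_def monom_subst_def using assms
  by (intro sum.mono_neutral_left) (auto simp: in_keys_iff)

lemma subst_add: "subst f (p + q) = subst f p + subst f q"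
proof -
  let ?S = "Poly_Mapping.keys p \<union> Poly_Mapping.keys q"
  have "subst f (p + q) = (\<Sum>m\<in>?S. const (Poly_Mapping.lookup (p + q) m) * monom_subst f m)"
    using keys_add[of p q] by (intro subst_superset) auto
  also have "\<dots> = subst f p + subst f q"
    by (simp add: subst_superset[of ?S] lookup_add const_add distrib_right sum.distrib)
  finally show ?thesis .
qed

lemma subst_0 [simp]: "subst f 0 = 0"
  by (simp add: subst_def)

lemma subst_sum: "subst f (sum p S) = (\<Sum>i\<in>S. subst f (p i))"
  by (induction S rule: infinite_finite_induct) (simp_all add: subst_add)

lemma subst_single: "subst f (Poly_Mapping.single m c) = const c * monom_subst f m"
  by (simp add: subst_superset[of "{m}"])

lemma subst_const [simp]: "subst f (const c) = const c"
  unfolding const_def subst_single by (simp add: monom_subst_def const_def)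

lemma subst_1 [simp]: "subst f 1 = 1"
  using subst_const[of f 1] by simp

lemma subst_var [simp]: "subst f (var i) = f i"
  by (simp add: var_def subst_single monom_subst_superset[of "{i}"])

lemma subst_mult: "subst f (p * q) = subst f p * subst f q"
proof -
  have "p * q = (\<Sum>m\<in>Poly_Mapping.keys p. \<Sum>m'\<in>Poly_Mapping.keys q.
      Poly_Mapping.single (m + m') (Poly_Mapping.lookup p m * Poly_Mapping.lookup q m'))"
    by (subst sum_monomials[of p], subst sum_monomials[of q]) (simp add: sum_product mult_single)
  then have "subst f (p * q) = (\<Sum>m\<in>Poly_Mapping.keys p. \<Sum>m'\<in>Poly_Mapping.keys q.
      (const (Poly_Mapping.lookup p m) * monom_subst f m) *
      (const (Poly_Mapping.lookup q m') * monom_subst f m'))"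
    by (simp add: subst_sum subst_single monom_subst_add const_mult algebra_simps)
  also have "\<dots> = subst f p * subst f q"
    by (simp add: sum_product subst_def monom_subst_def)
  finally show ?thesis .
qed

lemma subst_scale: "subst f (scale c p) = scale c (subst f p)"
  by (simp add: scale_def subst_mult)

lemma subst_power: "subst f (p ^ k) = subst f p ^ k"
  by (induction k) (simp_all add: subst_mult)

lemma subst_prod: "subst f (prod p S) = (\<Prod>i\<in>S. subst f (p i))"
  by (induction S rule: infinite_finite_induct) (simp_all add: subst_mult)

text \<open>The outer substitution passes through sums, products and powers, so only its effect on
  the polynomials \<open>f i\<close> remains.\<close>

lemma subst_subst: "subst g (subst f p) = subst (\<lambda>i. subst g (f i)) p"
proof -
  have "subst g (subst f p) = subst g (\<Sum>m\<in>Poly_Mapping.keys p. const (Poly_Mapping.lookup p m) *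
      (\<Prod>i\<in>Poly_Mapping.keys m. f i ^ Poly_Mapping.lookup m i))"
    by (simp add: subst_def)
  also have "\<dots> = subst (\<lambda>i. subst g (f i)) p"
    by (simp add: subst_sum subst_mult subst_prod subst_power) (simp add: subst_def)
  finally show ?thesis .
qed

section \<open>Evaluation at a point\<close>

definition eval_at :: "(nat \<Rightarrow> complex) \<Rightarrow> cpoly \<Rightarrow> complex"
  where "eval_at X p = (\<Sum>m\<in>Poly_Mapping.keys p. Poly_Mapping.lookup p m *
      (\<Prod>i\<in>Poly_Mapping.keys m. X i ^ Poly_Mapping.lookup m i))"

text \<open>Evaluation is substitution of constants; as \<open>const\<close> is injective, the
  homomorphism laws carry over from \<open>subst\<close>.\<close>

lemma const_eval_at: "const (eval_at X p) = subst (\<lambda>i. const (X i)) p"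
  by (simp add: eval_at_def subst_def const_sum const_mult const_prod const_power)

lemma eval_at_add: "eval_at X (p + q) = eval_at X p + eval_at X q"
  and eval_at_mult: "eval_at X (p * q) = eval_at X p * eval_at X q"
  and eval_at_const [simp]: "eval_at X (const c) = c"
  and eval_at_var [simp]: "eval_at X (var i) = X i"
  by (simp_all add: const_eval_at subst_add subst_mult const_add const_mult flip: const_inject)

lemma eval_at_0 [simp]: "eval_at X 0 = 0"
  by (simp add: eval_at_def)

lemma eval_at_1 [simp]: "eval_at X 1 = 1"
  using eval_at_const[of X 1] by simp

lemma eval_at_sum: "eval_at X (sum p S) = (\<Sum>i\<in>S. eval_at X (p i))"
  by (induction S rule: infinite_finite_induct) (simp_all add: eval_at_add)

lemma eval_at_scale: "eval_at X (scale c p) = c * eval_at X p"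
  by (simp add: scale_def eval_at_mult)

lemma eval_at_power: "eval_at X (p ^ k) = eval_at X p ^ k"
  by (induction k) (simp_all add: eval_at_mult)

lemma eval_at_subst: "eval_at X (subst f p) = eval_at (\<lambda>i. eval_at X (f i)) p"
  by (simp add: const_eval_at subst_subst flip: const_inject)

text \<open>Elements of the symmetric algebra are read as functions on the dual space, where
  \<open>A\<close> acts by its transpose: column \<open>j\<close> of \<open>A\<close>, paired with
  \<open>X\<close>, gives the new coordinate \<open>j\<close>.\<close>

lemma eval_at_sym_action:
  "eval_at X (sym_action n A p) = eval_at (\<lambda>j. \<Sum>i<n. A $$ (i, j) * X i) p"
  by (simp add: sym_action_def eval_at_subst eval_at_sum eval_at_scale)

section \<open>The third symmetric power and polarization\<close>

lemma sum_keys_superset: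
  fixes m :: "nat \<Rightarrow>\<^sub>0 nat"
  assumes "Poly_Mapping.keys m \<subseteq> {..<n}"
  shows "(\<Sum>i\<in>Poly_Mapping.keys m. Poly_Mapping.lookup m i) = (\<Sum>i<n. Poly_Mapping.lookup m i)"
  using assms by (intro sum.mono_neutral_left) (auto simp: in_keys_iff)

lemma mem_sym_power_iff:
  "p \<in> sym_power k n \<longleftrightarrow> (\<forall>m\<in>Poly_Mapping.keys p. Poly_Mapping.keys m \<subseteq> {..<n} \<and>
     (\<Sum>i<n. Poly_Mapping.lookup m i) = k)"
  unfolding sym_power_def by (auto simp: sum_keys_superset)

lemma lookup_scale [simp]: "Poly_Mapping.lookup (scale c p) m = c * Poly_Mapping.lookup p m"
proof -
  have "scale c p = (\<Sum>m\<in>Poly_Mapping.keys p. Poly_Mapping.single m (c * Poly_Mapping.lookup p m))"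
    by (subst sum_monomials[of p]) (simp add: scale_def const_def sum_distrib_left mult_single)
  then show ?thesis
    by (auto simp: lookup_sum lookup_single when_def in_keys_iff sum.delta' cong: if_cong)
qed

lemma subspace_sym_power: "cpoly.subspace (sym_power k n)"
proof (rule cpoly.subspaceI)
  show "0 \<in> sym_power k n"
    by (simp add: sym_power_def)
next
  fix p q assume "p \<in> sym_power k n" "q \<in> sym_power k n"
  then show "p + q \<in> sym_power k n"
    using keys_add[of p q] unfolding sym_power_def by blast
next
  fix c p assume "p \<in> sym_power k n"
  moreover have "Poly_Mapping.keys (scale c p) \<subseteq> Poly_Mapping.keys p"
    by (auto simp: in_keys_iff)
  ultimately show "scale c p \<in> sym_power k n"
    unfolding sym_power_def by blast
qed

lemma var_mult3: "var i * var j * var k = Poly_Mapping.single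
    (Poly_Mapping.single i 1 + Poly_Mapping.single j 1 + Poly_Mapping.single k 1) 1"
  by (simp add: var_def mult_single)

lemma sum_lookup_single:
  fixes i n :: nat
  shows "i < n \<Longrightarrow> (\<Sum>l<n. Poly_Mapping.lookup (Poly_Mapping.single i (Suc 0)) l) = 1"
  by (simp add: lookup_single when_def sum.delta')

lemma var_mult3_in_sym_power:
  assumes "i < n" "j < n" "k < n"
  shows "var i * var j * var k \<in> sym_power 3 n"
proof -
  let ?m = "Poly_Mapping.single i 1 + Poly_Mapping.single j 1 + Poly_Mapping.single k (1::nat)"
  have "Poly_Mapping.keys ?m \<subseteq> {i, j, k}"
    using keys_add[of "Poly_Mapping.single i 1 + Poly_Mapping.single j 1" "Poly_Mapping.single k (1::nat)"]
      keys_add[of "Poly_Mapping.single i 1" "Poly_Mapping.single j (1::nat)"] by auto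
  then show ?thesis
    using assms unfolding mem_sym_power_iff var_mult3
    by (auto simp: lookup_add sum.distrib sum_lookup_single)
qed

lemma sum_product3:
  fixes f g h :: "nat \<Rightarrow> 'a::comm_semiring_0"
  shows "sum f A * sum g B * sum h C = (\<Sum>i\<in>A. \<Sum>j\<in>B. \<Sum>k\<in>C. f i * g j * h k)"
proof -
  have "sum f A * sum g B * sum h C = (\<Sum>i\<in>A. \<Sum>j\<in>B. f i * g j) * sum h C"
    by (simp only: sum_product)
  also have "\<dots> = (\<Sum>i\<in>A. \<Sum>j\<in>B. f i * g j * sum h C)"
    by (simp only: sum_distrib_right)
  finally show ?thesis
    by (simp only: sum_distrib_left)
qed

lemma linear_mult3_in_sym_power:
  "(\<Sum>i<n. scale (a i) (var i)) * (\<Sum>i<n. scale (b i) (var i)) * (\<Sum>i<n. scale (c i) (var i))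
    \<in> sym_power 3 n"
proof -
  have "(\<Sum>i<n. scale (a i) (var i)) * (\<Sum>i<n. scale (b i) (var i)) * (\<Sum>i<n. scale (c i) (var i))
    = (\<Sum>i<n. \<Sum>j<n. \<Sum>k<n. scale (a i * b j * c k) (var i * var j * var k))"
    unfolding sum_product3 by (simp add: scale_def const_mult algebra_simps)
  also have "\<dots> \<in> sym_power 3 n"
    by (intro cpoly.subspace_sum[OF subspace_sym_power] cpoly.subspace_scale[OF subspace_sym_power]
      var_mult3_in_sym_power) auto
  finally show ?thesis .
qed

text \<open>A monomial of positive degree contains some variable, which can be split off; three
  rounds factor a cubic monomial.\<close>

lemma degree_Suc_split:
  fixes m :: "nat \<Rightarrow>\<^sub>0 nat"
  assumes "Poly_Mapping.keys m \<subseteq> {..<n}" "(\<Sum>i<n. Poly_Mapping.lookup m i) = Suc k"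
  obtains i m' where "i < n" "m = Poly_Mapping.single i 1 + m'" "Poly_Mapping.keys m' \<subseteq> {..<n}"
    "(\<Sum>i<n. Poly_Mapping.lookup m' i) = k"
proof -
  obtain i where i: "i < n" "Poly_Mapping.lookup m i \<noteq> 0"
    using assms(2) by (metis lessThan_iff nat.distinct(1) sum.neutral)
  define m' where "m' = m - Poly_Mapping.single i 1"
  have m: "m = Poly_Mapping.single i 1 + m'"
    using i(2) by (intro poly_mapping_eqI)
      (auto simp: m'_def lookup_add lookup_minus lookup_single when_def)
  have "Poly_Mapping.keys m' \<subseteq> {..<n}"
    using assms(1) m unfolding subset_iff in_keys_iff lookup_add by (metis add_is_0 lookup_add)
  moreover have "(\<Sum>i<n. Poly_Mapping.lookup m' i) = k"
    using assms(2) i(1) unfolding m by (simp add: lookup_add sum.distrib sum_lookup_single)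
  ultimately show thesis
    using that i(1) m by blast
qed

text \<open>Products of three variables, in any order and with repetitions, span the cubic forms, so
  linear properties need to be checked only on their multiples.\<close>

lemma sym_power_3_induct [consumes 1, case_names zero var add]:
  assumes "p \<in> sym_power 3 n"
    and "P 0"
    and var: "\<And>c i j k. i < n \<Longrightarrow> j < n \<Longrightarrow> k < n \<Longrightarrow> P (scale c (var i * var j * var k))"
    and add: "\<And>p q. P p \<Longrightarrow> P q \<Longrightarrow> P (p + q)"
  shows "P p"
proof -
  have "P (Poly_Mapping.single m (Poly_Mapping.lookup p m))" if "m \<in> Poly_Mapping.keys p" for m
  proof -
    have m: "Poly_Mapping.keys m \<subseteq> {..<n}" "(\<Sum>i<n. Poly_Mapping.lookup m i) = Suc (Suc (Suc 0))"
      using assms(1) that by (auto simp: mem_sym_power_iff)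
    obtain i m1 where i: "i < n" "m = Poly_Mapping.single i 1 + m1"
      "Poly_Mapping.keys m1 \<subseteq> {..<n}" "(\<Sum>i<n. Poly_Mapping.lookup m1 i) = Suc (Suc 0)"
      using degree_Suc_split[OF m] .
    obtain j m2 where j: "j < n" "m1 = Poly_Mapping.single j 1 + m2"
      "Poly_Mapping.keys m2 \<subseteq> {..<n}" "(\<Sum>i<n. Poly_Mapping.lookup m2 i) = Suc 0"
      using degree_Suc_split[OF i(3,4)] .
    obtain k m3 where k: "k < n" "m2 = Poly_Mapping.single k 1 + m3"
      "Poly_Mapping.keys m3 \<subseteq> {..<n}" "(\<Sum>i<n. Poly_Mapping.lookup m3 i) = 0"
      using degree_Suc_split[OF j(3,4)] .
    have "m3 = 0"
      using k(3,4) by (intro poly_mapping_eqI) (auto simp: in_keys_iff)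
    then have "Poly_Mapping.single m (Poly_Mapping.lookup p m)
        = scale (Poly_Mapping.lookup p m) (var i * var j * var k)"
      unfolding i(2) j(2) k(2) var_mult3 scale_def const_def by (simp add: mult_single add.assoc)
    then show ?thesis
      using var i(1) j(1) k(1) by simp
  qed
  then have "P (\<Sum>m\<in>S. Poly_Mapping.single m (Poly_Mapping.lookup p m))"
    if "S \<subseteq> Poly_Mapping.keys p" for S
    using that
  proof (induction S rule: infinite_finite_induct)
    case (insert x F)
    then show ?case by (auto intro!: add)
  qed (auto simp: \<open>P 0\<close>)
  from this[OF order.refl] show ?thesis
    by (simp flip: sum_monomials)
qed

text \<open>Variables go to linear forms, so a product of three variables goes to a product of three
  linear forms.\<close>

lemma sym_action_in_sym_power:
  assumes "p \<in> sym_power 3 n"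
  shows "sym_action n A p \<in> sym_power 3 n"
  using assms
proof (induction rule: sym_power_3_induct)
  case zero
  then show ?case
    by (simp add: sym_action_def cpoly.subspace_0[OF subspace_sym_power])
next
  case (var c i j k)
  then show ?case
    by (simp add: sym_action_def subst_scale subst_mult linear_mult3_in_sym_power
        cpoly.subspace_scale[OF subspace_sym_power])
next
  case (add p q)
  then show ?case
    by (simp add: sym_action_def subst_add cpoly.subspace_add[OF subspace_sym_power])
qed

text \<open>Inclusion-exclusion form of the full polarization, without division by 6: on a cubic
  form \<open>polar p X X X\<close> is 6 times the value of \<open>p\<close> at \<open>X\<close>.
  The term at the origin is absent, being zero for cubic forms.\<close>

definition polar :: "cpoly \<Rightarrow> (nat \<Rightarrow> complex) \<Rightarrow> (nat \<Rightarrow> complex) \<Rightarrow> (nat \<Rightarrow> complex) \<Rightarrow> complex"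
  where "polar p X Y Z = eval_at (\<lambda>i. X i + Y i + Z i) p
    - eval_at (\<lambda>i. X i + Y i) p - eval_at (\<lambda>i. Y i + Z i) p - eval_at (\<lambda>i. X i + Z i) p
    + eval_at X p + eval_at Y p + eval_at Z p"

lemma polar_0 [simp]: "polar 0 X Y Z = 0"
  and polar_add: "polar (p + q) X Y Z = polar p X Y Z + polar q X Y Z"
  and polar_scale: "polar (scale c p) X Y Z = c * polar p X Y Z"
  by (simp_all add: polar_def eval_at_add eval_at_scale algebra_simps)

lemma polar_diff: "polar (p - q) X Y Z = polar p X Y Z - polar q X Y Z"
  using polar_add[of "p - q" q X Y Z] by simp

lemma polar_sum: "polar (sum p S) X Y Z = (\<Sum>i\<in>S. polar (p i) X Y Z)"
  by (induction S rule: infinite_finite_induct) (simp_all add: polar_add)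

lemma polar_commute: "polar p X Y Z = polar p X Z Y"
  by (simp add: polar_def algebra_simps)

lemma polar_var: "polar (var i * var j * var k) X Y Z =
    X i * Y j * Z k + X i * Z j * Y k + Y i * X j * Z k + Y i * Z j * X k
      + Z i * X j * Y k + Z i * Y j * X k"
  by (simp add: polar_def eval_at_mult algebra_simps)

lemma polar_sym_action: "polar (sym_action n A p) X Y Z =
    polar p (\<lambda>j. \<Sum>i<n. A $$ (i, j) * X i) (\<lambda>j. \<Sum>i<n. A $$ (i, j) * Y i) (\<lambda>j. \<Sum>i<n. A $$ (i, j) * Z i)"
  by (simp add: polar_def eval_at_sym_action distrib_left sum.distrib)

lemma sum3_delta:
  fixes f :: "nat \<Rightarrow> nat \<Rightarrow> nat \<Rightarrow> 'a::comm_monoid_add"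
  assumes "i < n" "j < n" "k < n"
  shows "(\<Sum>r<n. \<Sum>s<n. \<Sum>t<n. if r = i \<and> s = j \<and> t = k then f r s t else 0) = f i j k"
proof -
  have "(\<Sum>t<n. if r = i \<and> s = j \<and> t = k then f r s t else 0)
      = (if r = i \<and> s = j then f r s k else 0)" for r s
    using assms by (cases "r = i \<and> s = j") (auto intro!: sum.neutral)
  moreover have "(\<Sum>s<n. if r = i \<and> s = j then f r s k else 0) = (if r = i then f r j k else 0)" for r
    using assms by (cases "r = i") simp_all
  ultimately show ?thesis
    using assms by simp
qed

text \<open>The factor 6 counts the orderings of the three indices.\<close>

lemma polar_trilinear:
  assumes "p \<in> sym_power 3 n"
  shows "\<exists>c. (\<forall>X Y Z. polar p X Y Z = (\<Sum>i<n. \<Sum>j<n. \<Sum>k<n. c i j k * (X i * Y j * Z k))) \<and>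
    scale 6 p = (\<Sum>i<n. \<Sum>j<n. \<Sum>k<n. scale (c i j k) (var i * var j * var k))"
  using assms
proof (induction rule: sym_power_3_induct)
  case zero
  show ?case
    by (rule exI[of _ "\<lambda>_ _ _. 0"]) simp
next
  case (var a i j k)
  \<comment> \<open>\<open>d\<close> is the coefficient array of a single product of coordinates;
    the array \<open>c\<close> below symmetrizes it over the six permutations of the
    indices.\<close>
  define d where "d i j k r s t = (if r = i \<and> s = j \<and> t = k then a else 0)"
    for i j k r s t :: nat
  have d: "(\<Sum>r<n. \<Sum>s<n. \<Sum>t<n. d i j k r s t * f r s t) = a * f i j k"
    if "i < n" "j < n" "k < n" for i j k and f :: "nat \<Rightarrow> nat \<Rightarrow> nat \<Rightarrow> complex"
    using sum3_delta[OF that, of "\<lambda>r s t. a * f r s t"]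
    by (simp add: d_def if_distrib[of "\<lambda>x. x * _"] cong: if_cong)
  have d': "(\<Sum>r<n. \<Sum>s<n. \<Sum>t<n. scale (d i j k r s t) (f r s t)) = scale a (f i j k)"
    if "i < n" "j < n" "k < n" for i j k and f :: "nat \<Rightarrow> nat \<Rightarrow> nat \<Rightarrow> cpoly"
    using sum3_delta[OF that, of "\<lambda>r s t. scale a (f r s t)"]
    by (simp add: d_def if_distrib[of "\<lambda>x. scale x _"] cong: if_cong)
  define c where "c r s t = d i j k r s t + d i k j r s t + d j i k r s t + d j k i r s t
    + d k i j r s t + d k j i r s t" for r s t
  have "polar (scale a (var i * var j * var k)) X Y Z
      = (\<Sum>i<n. \<Sum>j<n. \<Sum>k<n. c i j k * (X i * Y j * Z k))" for X Y Z
    by (simp only: c_def distrib_right sum.distrib d var polar_scale polar_var)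
      (simp add: algebra_simps)
  moreover have "(\<Sum>i<n. \<Sum>j<n. \<Sum>k<n. scale (c i j k) (var i * var j * var k))
      = scale a (var i * var j * var k) + scale a (var i * var k * var j)
      + scale a (var j * var i * var k) + scale a (var j * var k * var i)
      + scale a (var k * var i * var j) + scale a (var k * var j * var i)"
    by (simp only: c_def cpoly.scale_left_distrib sum.distrib d' var)
  then have "(\<Sum>i<n. \<Sum>j<n. \<Sum>k<n. scale (c i j k) (var i * var j * var k))
      = scale 6 (scale a (var i * var j * var k))"
    by (simp add: scale_def const_def algebra_simps)
  ultimately show ?case
    by (intro exI[of _ c]) simp
next
  case (add p q)
  then obtain c c' where
    "\<And>X Y Z. polar p X Y Z = (\<Sum>i<n. \<Sum>j<n. \<Sum>k<n. c i j k * (X i * Y j * Z k))"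
    "scale 6 p = (\<Sum>i<n. \<Sum>j<n. \<Sum>k<n. scale (c i j k) (var i * var j * var k))"
    "\<And>X Y Z. polar q X Y Z = (\<Sum>i<n. \<Sum>j<n. \<Sum>k<n. c' i j k * (X i * Y j * Z k))"
    "scale 6 q = (\<Sum>i<n. \<Sum>j<n. \<Sum>k<n. scale (c' i j k) (var i * var j * var k))"
    by blast
  then show ?case
    by (intro exI[of _ "\<lambda>i j k. c i j k + c' i j k"])
      (simp add: polar_add cpoly.scale_right_distrib cpoly.scale_left_distrib distrib_right sum.distrib)
qed

section \<open>The rational normal curve\<close>

text \<open>A form in \<open>n\<close> variables sees only the first \<open>n\<close> coordinates.
  This matters because identities for \<open>nu d\<close> hold only for indices up to
  \<open>d\<close>.\<close>

lemma polar_cong: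
  assumes "p \<in> sym_power 3 n" "\<And>i. i < n \<Longrightarrow> X i = X' i" "\<And>i. i < n \<Longrightarrow> Y i = Y' i"
    "\<And>i. i < n \<Longrightarrow> Z i = Z' i"
  shows "polar p X Y Z = polar p X' Y' Z'"
  using polar_trilinear[OF assms(1)] assms(2-4) by auto

lemma polar_scaled_args:
  assumes "p \<in> sym_power 3 n"
  shows "polar p (\<lambda>i. a * X i) (\<lambda>i. b * Y i) (\<lambda>i. c * Z i) = a * b * c * polar p X Y Z"
  using polar_trilinear[OF assms] by (auto simp: sum_distrib_left mult_ac)

text \<open>The affine cone over the rational normal curve of degree \<open>d\<close>: coordinate
  \<open>i\<close> is the value at \<open>u\<close> of the basis monomial \<open>i\<close> of binary
  forms. Truncated subtraction makes it meaningful for \<open>i\<close> up to \<open>d\<close>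
  only.\<close>

definition nu :: "nat \<Rightarrow> complex \<times> complex \<Rightarrow> nat \<Rightarrow> complex"
  where "nu d u i = fst u ^ (d - i) * snd u ^ i"

text \<open>A nonzero polynomial has finitely many roots, while the complement of a finite set in
  the complex numbers is infinite.\<close>

lemma coeffs_zero_if_roots_cofinite:
  fixes a :: "nat \<Rightarrow> complex"
  assumes "finite S" "\<And>z. z \<notin> S \<Longrightarrow> (\<Sum>k<Suc d. a k * z ^ k) = 0" "k < Suc d"
  shows "a k = 0"
proof (rule ccontr)
  assume "a k \<noteq> 0"
  then have "finite {z. (\<Sum>k\<le>d. a k * z ^ k) = 0}"
    using assms(3) polyfun_finite_roots[of a d] by auto
  moreover have "- S \<subseteq> {z. (\<Sum>k\<le>d. a k * z ^ k) = 0}"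
    using assms(2) by (auto simp: lessThan_Suc_atMost)
  ultimately have "finite (- S)"
    using finite_subset by blast
  then have "finite (UNIV :: complex set)"
    using assms(1) by (metis finite_compl)
  then show False
    using infinite_UNIV_char_0 by blast
qed

text \<open>The monomials in \<open>x\<close>, \<open>y\<close>, \<open>z\<close> are linearly
  independent as functions, even off the diagonals. Hence all coefficients of the trilinear form
  vanish, and with them \<open>p\<close>, which is recovered from them up to the factor 6.\<close>

lemma polar_nu_injective:
  assumes p: "p \<in> sym_power 3 (Suc d)"
    and zero: "\<And>x y z. x \<noteq> y \<Longrightarrow> y \<noteq> z \<Longrightarrow> x \<noteq> z \<Longrightarrow>
      polar p (nu d (1, x)) (nu d (1, y)) (nu d (1, z)) = 0"
  shows "p = 0"
proof -
  obtain c where c: "\<And>X Y Z. polar p X Y Z =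
      (\<Sum>i<Suc d. \<Sum>j<Suc d. \<Sum>k<Suc d. c i j k * (X i * Y j * Z k))"
    and p': "scale 6 p = (\<Sum>i<Suc d. \<Sum>j<Suc d. \<Sum>k<Suc d. scale (c i j k) (var i * var j * var k))"
    using polar_trilinear[OF p] by blast
  have eq: "polar p (nu d (1, x)) (nu d (1, y)) (nu d (1, z)) =
      (\<Sum>i<Suc d. (\<Sum>j<Suc d. (\<Sum>k<Suc d. c i j k * z ^ k) * y ^ j) * x ^ i)" for x y z
    unfolding c nu_def
    by (simp only: sum_distrib_left sum_distrib_right fst_conv snd_conv power_one mult_1_left mult_ac)
  \<comment> \<open>The variables are eliminated one at a time: \<open>x\<close> must avoid
    \<open>y\<close> and \<open>z\<close>, then \<open>y\<close> must avoid only \<open>z\<close>,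
    and \<open>z\<close> is finally unrestricted.\<close>
  have "(\<Sum>j<Suc d. (\<Sum>k<Suc d. c i j k * z ^ k) * y ^ j) = 0" if "y \<noteq> z" "i < Suc d" for i y z
    by (rule coeffs_zero_if_roots_cofinite[where S = "{y, z}" and d = d
          and a = "\<lambda>i. \<Sum>j<Suc d. (\<Sum>k<Suc d. c i j k * z ^ k) * y ^ j"])
      (use zero that in \<open>auto simp flip: eq simp del: sum.lessThan_Suc\<close>)
  then have "(\<Sum>k<Suc d. c i j k * z ^ k) = 0" if "i < Suc d" "j < Suc d" for i j z
    by (rule_tac coeffs_zero_if_roots_cofinite[where S = "{z}" and d = d
          and a = "\<lambda>j. \<Sum>k<Suc d. c i j k * z ^ k"])
      (use that in \<open>auto simp del: sum.lessThan_Suc\<close>)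
  then have "c i j k = 0" if "i < Suc d" "j < Suc d" "k < Suc d" for i j k
    by (rule_tac coeffs_zero_if_roots_cofinite[where S = "{}" and d = d and a = "c i j"])
      (use that in \<open>auto simp del: sum.lessThan_Suc\<close>)
  then have "scale 6 p = 0"
    unfolding p' by (intro sum.neutral ballI) (simp del: sum.lessThan_Suc)
  then show ?thesis
    by simp
qed

section \<open>Equivariance of the rational normal curve\<close>

definition transpose_act :: "complex mat \<Rightarrow> complex \<times> complex \<Rightarrow> complex \<times> complex"
  where "transpose_act A u =
    (A $$ (0, 0) * fst u + A $$ (1, 0) * snd u, A $$ (0, 1) * fst u + A $$ (1, 1) * snd u)"

abbreviation binary_monomials :: "nat \<Rightarrow> cpoly set"
  where "binary_monomials d \<equiv> (\<lambda>i. Poly_Mapping.single (binary_monomial d i) 1) ` {..d}"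

lemma var_power: "var i ^ k = Poly_Mapping.single (Poly_Mapping.single i k) 1"
  by (induction k) (simp_all add: var_def mult_single flip: single_add)

lemma single_binary_monomial:
  "Poly_Mapping.single (binary_monomial d i) 1 = var 0 ^ (d - i) * var 1 ^ i"
  by (simp add: var_power binary_monomial_def mult_single)

lemma binary_monomial_inject: "binary_monomial d i = binary_monomial d j \<longleftrightarrow> i = j"
proof
  assume "binary_monomial d i = binary_monomial d j"
  then have "Poly_Mapping.lookup (binary_monomial d i) 1 = Poly_Mapping.lookup (binary_monomial d j) 1"
    by simp
  then show "i = j"
    by (simp add: binary_monomial_def lookup_add lookup_single)
qed simp

text \<open>Induction step for products of linear forms. Knowing that these stay in the span of the
  basis monomials ensures that the entries of \<open>binary_sym_mat\<close> record the whole image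
  of a monomial.\<close>

lemma linear_mult_in_span:
  assumes "q \<in> cpoly.span (binary_monomials d)"
  shows "(scale a (var 0) + scale b (var 1)) * q \<in> cpoly.span (binary_monomials (Suc d))"
  using assms
proof (induction rule: cpoly.span_induct_alt)
  case base
  show ?case by (simp add: cpoly.span_zero)
next
  case (step c x y)
  then obtain i where i: "i \<le> d" "x = Poly_Mapping.single (binary_monomial d i) 1"
    by auto
  have x: "var 0 * x = Poly_Mapping.single (binary_monomial (Suc d) i) 1"
    "var 1 * x = Poly_Mapping.single (binary_monomial (Suc d) (Suc i)) 1"
    unfolding i(2) single_binary_monomial using i(1) by (simp_all add: Suc_diff_le mult_ac)
  have "(scale a (var 0) + scale b (var 1)) * (scale c x + y)
      = scale (a * c) (var 0 * x) + scale (b * c) (var 1 * x) + (scale a (var 0) + scale b (var 1)) * y"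
    by (simp add: scale_def const_mult algebra_simps)
  also have "\<dots> \<in> cpoly.span (binary_monomials (Suc d))"
    unfolding x by (rule cpoly.span_add[OF cpoly.span_add[OF cpoly.span_scale cpoly.span_scale] step.IH])
      (use i(1) in \<open>auto intro!: cpoly.span_base\<close>)
  finally show ?case .
qed

lemma linear_powers_in_span:
  "(scale a (var 0) + scale b (var 1)) ^ k * (scale a' (var 0) + scale b' (var 1)) ^ l
    \<in> cpoly.span (binary_monomials (k + l))"
proof (induction k)
  case 0
  have "(scale a' (var 0) + scale b' (var 1)) ^ l \<in> cpoly.span (binary_monomials l)"
  proof (induction l)
    case 0
    have "1 = Poly_Mapping.single (binary_monomial 0 0) (1::complex)"
      by (simp add: binary_monomial_def)
    then show ?case by (auto intro: cpoly.span_base)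
  next
    case (Suc l)
    then show ?case by (simp only: power_Suc linear_mult_in_span)
  qed
  then show ?case by simp
next
  case (Suc k)
  then show ?case by (simp only: power_Suc add_Suc mult.assoc linear_mult_in_span)
qed

text \<open>Pairing the coefficients of a binary form with \<open>nu d u\<close> evaluates it at
  \<open>u\<close>. The evaluation point repeats \<open>snd u\<close> beyond index 1, where no
  variable of \<open>q\<close> occurs.\<close>

lemma sum_lookup_binary_form:
  assumes "q \<in> cpoly.span (binary_monomials d)"
  shows "(\<Sum>i<Suc d. Poly_Mapping.lookup q (binary_monomial d i) * nu d u i)
    = eval_at (\<lambda>i. if i = 0 then fst u else snd u) q"
  using assms
proof (induction rule: cpoly.span_induct_alt)
  case base
  show ?case by simp
next
  case (step c x y)
  then obtain i where i: "i \<le> d" "x = Poly_Mapping.single (binary_monomial d i) 1"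
    by auto
  have "(\<Sum>j<Suc d. Poly_Mapping.lookup x (binary_monomial d j) * nu d u j)
      = (\<Sum>j<Suc d. if j = i then nu d u j else 0)"
    unfolding i(2) by (intro sum.cong refl) (auto simp: lookup_single when_def binary_monomial_inject)
  also have "\<dots> = nu d u i"
    using i(1) by (simp del: sum.lessThan_Suc)
  also have "\<dots> = eval_at (\<lambda>i. if i = 0 then fst u else snd u) x"
    unfolding i(2) single_binary_monomial by (simp add: eval_at_mult eval_at_power nu_def)
  finally show ?case
    using step.IH
    by (simp add: lookup_add distrib_right sum.distrib eval_at_add eval_at_scale mult.assoc
        flip: sum_distrib_left del: sum.lessThan_Suc)
qed

text \<open>Column \<open>j\<close> holds the coefficients of a product of powers of two linear
  forms, and these linear forms take the coordinates of \<open>transpose_act A u\<close> as their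
  values at \<open>u\<close>.\<close>

lemma binary_sym_mat_nu:
  assumes "j < Suc d"
  shows "(\<Sum>i<Suc d. binary_sym_mat d A $$ (i, j) * nu d u i) = nu d (transpose_act A u) j"
proof -
  let ?q = "sym_action 2 A (Poly_Mapping.single (binary_monomial d j) 1)"
  have q: "?q = (scale (A $$ (0, 0)) (var 0) + scale (A $$ (1, 0)) (var 1)) ^ (d - j) *
      (scale (A $$ (0, 1)) (var 0) + scale (A $$ (1, 1)) (var 1)) ^ j"
    by (simp add: single_binary_monomial sym_action_def subst_mult subst_power numeral_2_eq_2)
  have "(\<Sum>i<Suc d. binary_sym_mat d A $$ (i, j) * nu d u i)
      = (\<Sum>i<Suc d. Poly_Mapping.lookup ?q (binary_monomial d i) * nu d u i)"
    using assms by (intro sum.cong refl) (simp add: binary_sym_mat_def)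
  also have "\<dots> = eval_at (\<lambda>i. if i = 0 then fst u else snd u) ?q"
    using linear_powers_in_span[of _ _ "d - j" _ _ j] assms unfolding q
    by (intro sum_lookup_binary_form) simp
  also have "\<dots> = nu d (transpose_act A u) j"
    unfolding q by (simp add: eval_at_mult eval_at_power eval_at_add eval_at_scale nu_def transpose_act_def)
  finally show ?thesis .
qed

lemma polar_binary_sym_mat:
  assumes "p \<in> sym_power 3 (Suc d)"
  shows "polar (sym_action (Suc d) (binary_sym_mat d A) p) (nu d u) (nu d v) (nu d w)
    = polar p (nu d (transpose_act A u)) (nu d (transpose_act A v)) (nu d (transpose_act A w))"
  unfolding polar_sym_action
  by (rule polar_cong[OF assms]) (simp_all add: binary_sym_mat_nu del: sum.lessThan_Suc)

section \<open>Semi-invariants of binary triples\<close>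

lemma det_mat_2:
  assumes "A \<in> carrier_mat 2 2"
  shows "det A = A $$ (0, 0) * A $$ (1, 1) - A $$ (0, 1) * A $$ (1, 0)"
proof -
  have "det A = (\<Sum>i<2. A $$ (i, 0) * cofactor A i 0)"
    by (rule laplace_expansion_column[OF assms]) simp
  also have "\<dots> = A $$ (0, 0) * A $$ (1, 1) - A $$ (0, 1) * A $$ (1, 0)"
    using assms by (simp add: numeral_2_eq_2 cofactor_def det_single mat_delete_def)
  finally show ?thesis .
qed

text \<open>The number \<open>- \<i>\<close> has multiplicative order 4; the exponent is reduced
  modulo 4 and the four residues are checked.\<close>

lemma neg_imaginary_unit_power_eq_1:
  assumes "(- \<i>) ^ d = 1"
  shows "4 dvd d"
proof -
  have "(- \<i>) ^ d = (- \<i>) ^ (4 * (d div 4) + d mod 4)"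
    by simp
  also have "\<dots> = (- \<i>) ^ (d mod 4)"
    unfolding power_add power_mult by (simp add: power4_eq_xxxx)
  finally have "(- \<i>) ^ (d mod 4) = 1"
    using assms by simp
  moreover have "d mod 4 = 0 \<or> d mod 4 = 1 \<or> d mod 4 = 2 \<or> d mod 4 = 3"
    by linarith
  ultimately have "d mod 4 = 0"
    by (auto simp: complex_eq_iff power2_eq_square power3_eq_cube)
  then show ?thesis by auto
qed

text \<open>An element of \<open>SL\<^sub>2\<close> carries the triple \<open>(1, 0), (1, 1), (1, -1)\<close> to multiples of any
  given affine triple, so \<open>E\<close> does not vanish on it. The diagonal matrix with entries \<open>\<i>\<close> and
  \<open>-\<i>\<close> maps that triple to \<open>\<i>\<close> times itself with the last two members exchanged; being a
  commutator, it acts by the scalar 1.\<close>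

lemma semi_invariant_degree:
  fixes E :: "complex \<times> complex \<Rightarrow> complex \<times> complex \<Rightarrow> complex \<times> complex \<Rightarrow> complex"
  assumes sym: "\<And>u v w. E u v w = E u w v"
    and hom: "\<And>a b c u v w. E (a * fst u, a * snd u) (b * fst v, b * snd v) (c * fst w, c * snd w)
      = (a * b * c) ^ d * E u v w"
    and semi: "\<And>A. A \<in> SL 2 \<Longrightarrow>
      \<exists>k. \<forall>u v w. E (transpose_act A u) (transpose_act A v) (transpose_act A w) = k * E u v w"
    and nonzero: "x \<noteq> y" "y \<noteq> z" "x \<noteq> z" "E (1, x) (1, y) (1, z) \<noteq> 0"
  shows "4 dvd d"
proof -
  \<comment> \<open>\<open>act\<close> lists the entries by rows of the transformation that really
    acts on points, so transposes disappear from the computations below.\<close>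
  define act :: "complex \<Rightarrow> complex \<Rightarrow> complex \<Rightarrow> complex \<Rightarrow> complex \<times> complex \<Rightarrow> complex \<times> complex"
    where "act a b c e u = (a * fst u + b * snd u, c * fst u + e * snd u)" for a b c e u
  have char: "\<exists>k. \<forall>u v w. E (act a b c e u) (act a b c e v) (act a b c e w) = k * E u v w"
    if "a * e - b * c = 1" for a b c e
  proof -
    define A where "A = mat 2 2 (\<lambda>(i, j). if j = 0 then if i = 0 then a else b else if i = 0 then c else e)"
    have "A \<in> SL 2"
      using that by (simp add: SL_def det_mat_2 A_def algebra_simps)
    moreover have "transpose_act A = act a b c e"
      by (simp add: fun_eq_iff transpose_act_def act_def A_def)
    ultimately show ?thesis
      using semi by metis
  qed

  \<comment> \<open>These weights satisfy 2 \<alpha> (1, x) = \<beta> (1, y) + \<gamma> (1, z),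
    matching the relation 2 (1, 0) = (1, 1) + (1, -1). So one linear map sends the standard vectors
    to the weighted ones.\<close>
  define \<alpha> \<beta> \<gamma> where "\<alpha> = (z - y) / 2" and "\<beta> = z - x" and "\<gamma> = x - y"
  have nz: "\<alpha> \<noteq> 0" "\<beta> \<noteq> 0" "\<gamma> \<noteq> 0"
    using nonzero by (auto simp: \<alpha>_def \<beta>_def \<gamma>_def)
  \<comment> \<open>The determinant of that map is - \<alpha> \<beta> \<gamma>; dividing the map by
    a square root of it gives determinant 1.\<close>
  define s where "s = csqrt (- (\<alpha> * \<beta> * \<gamma>))"
  have s2: "s\<^sup>2 = - (\<alpha> * \<beta> * \<gamma>)"
    by (simp add: s_def)
  with nz have s: "s \<noteq> 0" by auto
  define T where "T = act (\<alpha> / s) ((\<beta> - \<gamma>) / (2 * s)) (\<alpha> * x / s) ((\<beta> * y - \<gamma> * z) / (2 * s))"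
  have "\<alpha> / s * (X / (2 * s)) - Y / (2 * s) * (\<alpha> * x / s)
      = (\<alpha> * X - Y * (\<alpha> * x)) / (2 * s\<^sup>2)" for X Y
    by (simp add: power2_eq_square diff_divide_distrib mult_ac)
  then have "\<alpha> / s * ((\<beta> * y - \<gamma> * z) / (2 * s)) - (\<beta> - \<gamma>) / (2 * s) * (\<alpha> * x / s)
      = (\<alpha> * (\<beta> * y - \<gamma> * z) - (\<beta> - \<gamma>) * (\<alpha> * x)) / (2 * s\<^sup>2)"
    .
  also have "\<alpha> * (\<beta> * y - \<gamma> * z) - (\<beta> - \<gamma>) * (\<alpha> * x) = 2 * s\<^sup>2"
    unfolding s2 \<beta>_def \<gamma>_def by (simp add: algebra_simps)
  also have "2 * s\<^sup>2 / (2 * s\<^sup>2) = 1"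
    using s by simp
  finally obtain k where k: "\<And>u v w. E (T u) (T v) (T w) = k * E u v w"
    using char unfolding T_def by blast
  have T0: "T (1, 0) = (\<alpha> / s * fst (1 :: complex, x), \<alpha> / s * snd (1 :: complex, x))"
    using s by (simp add: T_def act_def)
  have "\<beta> + \<gamma> = 2 * \<alpha>" "\<beta> * y + \<gamma> * z = 2 * (\<alpha> * x)"
    by (simp_all add: \<alpha>_def \<beta>_def \<gamma>_def field_simps)
  then have "\<alpha> / s = (\<beta> + \<gamma>) / (2 * s)" "\<alpha> * x / s = (\<beta> * y + \<gamma> * z) / (2 * s)"
    by simp_all
  then have T12: "T (1, 1) = (\<beta> / s * fst (1 :: complex, y), \<beta> / s * snd (1 :: complex, y))"
    "T (1, -1) = (\<gamma> / s * fst (1 :: complex, z), \<gamma> / s * snd (1 :: complex, z))"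
    unfolding T_def act_def by (simp_all flip: add_divide_distrib diff_divide_distrib)
  have "k * E (1, 0) (1, 1) (1, -1)
      = (\<alpha> / s * (\<beta> / s) * (\<gamma> / s)) ^ d * E (1, x) (1, y) (1, z)"
    unfolding k[symmetric] T0 T12 by (rule hom)
  then have E0: "E (1, 0) (1, 1) (1, -1) \<noteq> 0"
    using nz s nonzero by auto

  define \<omega> where "\<omega> = csqrt \<i>"
  have \<omega>2: "\<omega> * \<omega> = \<i>"
    unfolding \<omega>_def by (metis power2_csqrt power2_eq_square)
  then have \<omega>: "\<omega> \<noteq> 0" by auto
  \<comment> \<open>The choice of \<omega> gives \<open>g\<close> = \<open>t\<close>
    \<open>w\<close> \<open>t'\<close> \<open>w\<close>^(-1), with \<open>t'\<close> inverse to
    \<open>t\<close>. This is the commutator that forces the scalar of \<open>g\<close> to be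
    1.\<close>
  define t t' w g where "t = act \<omega> 0 0 (1 / \<omega>)" and "t' = act (1 / \<omega>) 0 0 \<omega>"
    and "w = act 0 1 (-1) 0" and "g = act \<i> 0 0 (-\<i>)"
  obtain kt where kt: "\<And>a b c. E (t a) (t b) (t c) = kt * E a b c"
    using char[of \<omega> "1 / \<omega>" 0 0] \<omega> unfolding t_def by auto
  obtain kt' where kt': "\<And>a b c. E (t' a) (t' b) (t' c) = kt' * E a b c"
    using char[of "1 / \<omega>" \<omega> 0 0] \<omega> unfolding t'_def by auto
  obtain kw where kw: "\<And>a b c. E (w a) (w b) (w c) = kw * E a b c"
    using char[of 0 0 1 "-1"] unfolding w_def by auto
  obtain kg where kg: "\<And>a b c. E (g a) (g b) (g c) = kg * E a b c"
    using char[of \<i> "-\<i>" 0 0] unfolding g_def by auto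
  have "t' (t u) = u" for u
    using \<omega> by (simp add: t_def t'_def act_def)
  then have "kt' * kt * E (1, 0) (1, 1) (1, -1) = E (1, 0) (1, 1) (1, -1)"
    using kt kt' by (metis mult.assoc)
  with E0 have "kt \<noteq> 0" by auto
  \<comment> \<open>As \<open>w\<close> has order 4, its scalar is a fourth root of unity and can be
    cancelled.\<close>
  have "w (w (w (w u))) = u" for u
    by (simp add: w_def act_def)
  then have "kw * (kw * (kw * (kw * E (1, 0) (1, 1) (1, -1)))) = E (1, 0) (1, 1) (1, -1)"
    using kw by metis
  with E0 have "kw \<noteq> 0" by auto
  have i\<omega>: "\<i> / \<omega> = \<omega>" "\<i> * \<omega> = - 1 / \<omega>"
    using \<omega> \<omega>2 by (simp_all add: field_simps)
  have "\<i> * b / \<omega> = \<omega> * b" "\<i> * (\<omega> * b) = - (b / \<omega>)" for b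
    using arg_cong[OF i\<omega>(1), of "\<lambda>r. r * b"] arg_cong[OF i\<omega>(2), of "\<lambda>r. r * b"]
    by (simp_all add: mult.assoc)
  then have "g (w (t u)) = t (w u)" for u
    by (simp add: g_def w_def t_def act_def)
  then have "kg * (kw * (kt * E (1, 0) (1, 1) (1, -1))) = kt * (kw * E (1, 0) (1, 1) (1, -1))"
    using kg kw kt by metis
  with E0 \<open>kt \<noteq> 0\<close> \<open>kw \<noteq> 0\<close> have "kg = 1" by simp
  have "E (1, 0) (1, 1) (1, -1) = E (g (1, 0)) (g (1, 1)) (g (1, -1))"
    using kg \<open>kg = 1\<close> by simp
  also have "\<dots> = (\<i> * \<i> * \<i>) ^ d * E (1, 0) (1, -1) (1, 1)"
    using hom[of \<i> "(1, 0)" \<i> "(1, -1)" \<i> "(1, 1)"] by (simp add: g_def act_def)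
  also have "\<dots> = (- \<i>) ^ d * E (1, 0) (1, 1) (1, -1)"
    using sym[of "(1, 0)" "(1, -1)"] by simp
  finally show ?thesis
    using E0 neg_imaginary_unit_power_eq_1 by simp
qed

text \<open>The polarization of a generator of the line, restricted to the curve, is a
  semi-invariant function of three points. Injectivity of this restriction supplies a triple of
  distinct points where it is nonzero.\<close>

lemma detects_sym_SL2_imp_dvd:
  assumes "detects scale (sym_power 3 (Suc d)) (sym_action (Suc d)) (sym_SL2 d)"
  shows "4 dvd d"
proof -
  obtain L where L: "cpoly.subspace L" "cpoly.dim L = 1" "L \<subseteq> sym_power 3 (Suc d)"
    "\<And>g. g \<in> sym_SL2 d \<Longrightarrow> sym_action (Suc d) g ` L \<subseteq> L"
    using assms unfolding detects_def by blast
  obtain B where B: "B \<subseteq> L" "cpoly.independent B" "L \<subseteq> cpoly.span B" "card B = cpoly.dim L"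
    using cpoly.basis_exists by blast
  then obtain v where v: "B = {v}"
    using L(2) by (metis card_1_singletonE)
  have "v \<noteq> 0" and vL: "v \<in> L" and p: "v \<in> sym_power 3 (Suc d)"
    using B L(3) v cpoly.dependent_zero by auto
  then obtain x y z where xyz: "x \<noteq> y" "y \<noteq> z" "x \<noteq> z"
    "polar v (nu d (1, x)) (nu d (1, y)) (nu d (1, z)) \<noteq> 0"
    using polar_nu_injective by blast
  have nu_scaled: "nu d (a * fst u, a * snd u) i = a ^ d * nu d u i" if "i < Suc d" for a u i
  proof -
    have "a ^ d = a ^ (d - i) * a ^ i"
      using that by (simp flip: power_add)
    then show ?thesis
      by (simp add: nu_def power_mult_distrib mult_ac)
  qed
  show ?thesis
  proof (rule semi_invariant_degree[where E = "\<lambda>a b c. polar v (nu d a) (nu d b) (nu d c)", OF _ _ _ xyz])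
    show "polar v (nu d a) (nu d b) (nu d c) = polar v (nu d a) (nu d c) (nu d b)" for a b c
      by (rule polar_commute)
    show "polar v (nu d (a * fst u, a * snd u)) (nu d (b * fst u', b * snd u'))
        (nu d (c * fst u'', c * snd u''))
      = (a * b * c) ^ d * polar v (nu d u) (nu d u') (nu d u'')" for a b c u u' u''
      unfolding power_mult_distrib polar_scaled_args[OF p, symmetric]
      by (rule polar_cong[OF p]) (simp_all add: nu_scaled)
    fix A assume "A \<in> SL 2"
    then have "sym_action (Suc d) (binary_sym_mat d A) v \<in> L"
      using L(4)[of "binary_sym_mat d A"] vL by (auto simp: sym_SL2_def)
    then obtain k where "sym_action (Suc d) (binary_sym_mat d A) v = scale k v"
      using B(3) v by (auto simp: cpoly.span_singleton)
    then show "\<exists>k. \<forall>a b c. polar v (nu d (transpose_act A a)) (nu d (transpose_act A b)) (nu d (transpose_act A c))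
        = k * polar v (nu d a) (nu d b) (nu d c)"
      by (metis polar_binary_sym_mat[OF p] polar_scale)
  qed
qed

section \<open>The cubic invariant\<close>

definition bracket :: "complex \<times> complex \<Rightarrow> complex \<times> complex \<Rightarrow> complex"
  where "bracket u v = fst u * snd v - snd u * fst v"

text \<open>The bracket is a 2 by 2 determinant, so any \<open>A\<close> multiplies it by
  \<open>det A\<close>.\<close>

lemma bracket_transpose_act:
  assumes "A \<in> SL 2"
  shows "bracket (transpose_act A u) (transpose_act A v) = bracket u v"
proof -
  have "A $$ (0, 0) * A $$ (1, 1) - A $$ (0, 1) * A $$ (1, 0) = 1"
    using assms det_mat_2[of A] unfolding SL_def by simp
  moreover have "bracket (transpose_act A u) (transpose_act A v)
      = (A $$ (0, 0) * A $$ (1, 1) - A $$ (0, 1) * A $$ (1, 0)) * bracket u v"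
    by (simp add: bracket_def transpose_act_def algebra_simps)
  ultimately show ?thesis by simp
qed

lemma bracket_swap_even: "even e \<Longrightarrow> bracket v u ^ e = bracket u v ^ e"
proof -
  assume "even e"
  moreover have "bracket v u = - bracket u v"
    by (simp add: bracket_def)
  ultimately show ?thesis by simp
qed

definition signed_choose :: "nat \<Rightarrow> nat \<Rightarrow> complex"
  where "signed_choose e a = (- 1) ^ a * of_nat (e choose a)"

lemma bracket_power: "bracket u v ^ e =
  (\<Sum>a\<le>e. signed_choose e a * ((snd u * fst v) ^ a * (fst u * snd v) ^ (e - a)))"
proof -
  have "bracket u v ^ e = (- (snd u * fst v) + fst u * snd v) ^ e"
    by (simp add: bracket_def)
  also have "\<dots> = (\<Sum>a\<le>e. of_nat (e choose a) * (- (snd u * fst v)) ^ a * (fst u * snd v) ^ (e - a))"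
    by (rule binomial_ring)
  also have "\<dots> = (\<Sum>a\<le>e. signed_choose e a * ((snd u * fst v) ^ a * (fst u * snd v) ^ (e - a)))"
    by (intro sum.cong refl) (subst power_minus, simp add: signed_choose_def mult_ac)
  finally show ?thesis .
qed

text \<open>In the term \<open>a\<close>, \<open>b\<close>, \<open>c\<close> the exponent of
  \<open>snd u\<close> is \<open>a\<close> from the bracket of \<open>u\<close>, \<open>v\<close>
  and \<open>e - c\<close> from that of \<open>w\<close>, \<open>u\<close>; the other two points
  follow cyclically. Each point has total degree \<open>2 * e\<close>.\<close>

lemma bracket_product:
  "bracket u v ^ e * bracket v w ^ e * bracket w u ^ e =
    (\<Sum>a\<le>e. \<Sum>b\<le>e. \<Sum>c\<le>e. signed_choose e a * signed_choose e b * signed_choose e c *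
      (nu (2 * e) u (a + (e - c)) * nu (2 * e) v (b + (e - a)) * nu (2 * e) w (c + (e - b))))"
proof -
  have nu: "nu (2 * e) u (a + (e - c)) = fst u ^ (e - a) * fst u ^ c * (snd u ^ a * snd u ^ (e - c))"
    if "a \<le> e" "c \<le> e" for a c u
  proof -
    have "2 * e - (a + (e - c)) = (e - a) + c"
      using that by simp
    then show ?thesis
      by (simp only: nu_def power_add)
  qed
  show ?thesis
    unfolding bracket_power sum_product3
  proof (intro sum.cong refl, goal_cases)
    case (1 a b c)
    then show ?case
      by (simp only: nu atMost_iff power_mult_distrib) (simp only: mult_ac)
  qed
qed

text \<open>The cubic invariant is the image of \<open>(u \<and> v)\<^sup>e (v \<and> w)\<^sup>e (w \<and> u)\<^sup>e\<close>, viewed as a trilinear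
  form on binary forms of degree \<open>2 e\<close>; it is symmetric exactly when \<open>e\<close> is even.\<close>

definition cubic_invariant :: "nat \<Rightarrow> cpoly"
  where "cubic_invariant e =
    (\<Sum>a\<le>e. \<Sum>b\<le>e. \<Sum>c\<le>e. scale (signed_choose e a * signed_choose e b * signed_choose e c)
      (var (a + (e - c)) * var (b + (e - a)) * var (c + (e - b))))"

lemma cubic_invariant_in_sym_power: "cubic_invariant e \<in> sym_power 3 (Suc (2 * e))"
  unfolding cubic_invariant_def
  by (intro cpoly.subspace_sum[OF subspace_sym_power] cpoly.subspace_scale[OF subspace_sym_power]
    var_mult3_in_sym_power) auto

text \<open>Polarization sums the bracket product over the six orderings of the points; for even
  \<open>e\<close> the powers ignore the sign of a swap and all six terms agree.\<close>

lemma polar_cubic_invariant: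
  assumes "even e"
  shows "polar (cubic_invariant e) (nu (2 * e) u) (nu (2 * e) v) (nu (2 * e) w)
    = 6 * (bracket u v ^ e * bracket v w ^ e * bracket w u ^ e)"
proof -
  let ?B = "\<lambda>u v w. bracket u v ^ e * bracket v w ^ e * bracket w u ^ e"
  have "polar (cubic_invariant e) (nu (2 * e) u) (nu (2 * e) v) (nu (2 * e) w)
      = ?B u v w + ?B u w v + ?B v u w + ?B v w u + ?B w u v + ?B w v u"
    by (simp only: cubic_invariant_def polar_sum polar_scale polar_var distrib_left sum.distrib
        bracket_product)
  then show ?thesis
    using bracket_swap_even[OF assms, of v u] bracket_swap_even[OF assms, of w v]
      bracket_swap_even[OF assms, of u w] by simp
qed

lemma dvd_imp_detects_sym_SL2:
  assumes "4 dvd d"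
  shows "detects scale (sym_power 3 (Suc d)) (sym_action (Suc d)) (sym_SL2 d)"
proof -
  obtain e where e: "even e" and d: "d = 2 * e"
    using assms by (metis dvdE dvd_triv_left mult.assoc numeral_Bit0 mult_2)
  let ?v = "cubic_invariant e" and ?S = "sym_power 3 (Suc d)"
  have v: "?v \<in> ?S"
    unfolding d by (rule cubic_invariant_in_sym_power)
  \<comment> \<open>At these three points the brackets are 1, 1 and -2, so the invariant is not
    zero.\<close>
  have "polar ?v (nu d (1, 0)) (nu d (1, 1)) (nu d (1, 2)) \<noteq> 0"
    unfolding d polar_cubic_invariant[OF e] by (simp add: bracket_def)
  then have "?v \<noteq> 0" by auto
  have inv: "sym_action (Suc d) (binary_sym_mat d A) ?v = ?v" if "A \<in> SL 2" for A
  proof -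
    let ?g = "sym_action (Suc d) (binary_sym_mat d A) ?v"
    have "?g - ?v = 0"
    proof (rule polar_nu_injective)
      show "?g - ?v \<in> ?S"
        by (intro cpoly.subspace_diff[OF subspace_sym_power] sym_action_in_sym_power v)
      show "polar (?g - ?v) (nu d (1, x)) (nu d (1, y)) (nu d (1, z)) = 0" for x y z
        unfolding polar_diff polar_binary_sym_mat[OF v]
        by (simp add: d polar_cubic_invariant[OF e] bracket_transpose_act[OF that])
    qed
    then show ?thesis by simp
  qed
  show ?thesis
    unfolding detects_def
  proof (intro exI[of _ "cpoly.span {?v}"] conjI ballI)
    show "cpoly.subspace (cpoly.span {?v})"
      by (rule cpoly.subspace_span)
    show "cpoly.dim (cpoly.span {?v}) = 1"
      using \<open>?v \<noteq> 0\<close> by (subst cpoly.dim_span_eq_card_independent) auto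
    show "cpoly.span {?v} \<subseteq> ?S"
      using v by (intro cpoly.span_minimal subspace_sym_power) simp
    fix g assume "g \<in> sym_SL2 d"
    then show "sym_action (Suc d) g ` cpoly.span {?v} \<subseteq> cpoly.span {?v}"
      using inv by (auto simp: sym_SL2_def cpoly.span_singleton sym_action_def subst_scale)
  qed
qed

theorem theorem3p2:
  fixes n :: nat
  assumes "n \<ge> 1"
  shows "detects scale (sym_power 3 n) (sym_action n) (sym_SL2 (n - 1)) \<longleftrightarrow> [n = 1] (mod 4)"
proof -
  obtain d where n: "n = Suc d"
    using assms by (cases n) auto
  have "[n = 1] (mod 4) \<longleftrightarrow> 4 dvd d"
    unfolding n cong_def by presburger
  then show ?thesis
    using detects_sym_SL2_imp_dvd[of d] dvd_imp_detects_sym_SL2[of d] by (auto simp: n)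
qed

end
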